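(* Let the wreath product $\mathbb{Z}\wr\mathbb{Z}=\mathbb{Z}\ltimes\bigoplus_{i\in\mathbb{Z}}\mathbb{Z}$ be marked by the elements $\big((1,0),(0,e_0)\big)$, where $e_0\in\bigoplus_{i\in\mathbb{Z}}\mathbb{Z}$ is the Dirac mass at $0$. For nonzero integers $m,n$ let $BS(m,n)=\langle a,b\mid ab^{m}a^{-1}=b^{n}\rangle$, marked by $(a,b)$. Then, in the space $\mathcal{G}_2$ of marked groups on two generators, $BS(1,n)\to\mathbb{Z}\wr\mathbb{Z}$ and $BS(-1,n)\to\mathbb{Z}\wr\mathbb{Z}$ when $|n|\to\infty$.
   Context: In $\mathbb{Z}\wr\mathbb{Z}$ the generator of $\mathbb{Z}$ acts on $\bigoplus_{i\in\mathbb{Z}}\mathbb{Z}$ by the shift, so that $(1,0)(0,e_i)(1,0)^{-1}=(0,e_{i+1})$, where $e_i$ denotes the Dirac mass at $i$. A marked group on $k$ generators is a pair $(\Gamma,S)$ with $\Gamma$ a group and $S=(s_1,\dots,s_k)$ a family generating $\Gamma$. Two marked groups $(\Gamma,S)$, $(\Gamma',S')$ are identified if there is a group isomorphism $\Gamma\to\Gamma'$ sending $s_i$ to $s'_i$ for each $i$; $\mathcal{G}_k$ is the set of marked groups on $k$ generators up to this identification. The topology on $\mathcal{G}_k$ is given by the ultrametric $d\big((\Gamma_1,S_1),(\Gamma_2,S_2)\big)=e^{-\lambda}$ for distinct marked groups, where $\lambda$ is the length of a shortest element of the free group $\mathbb{F}_k$ which is trivial in one of the groups and not in the other (under the canonical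 epimorphisms from $\mathbb{F}_k$). *)

theory Defs
  imports "HOL-Analysis.Analysis" "HOL-Algebra.Product_Groups" "HOL-Algebra.Generated_Groups"
begin

section \<open>Free groups\<close>

text \<open>A letter \<open>(x, True)\<close> stands for \<open>x\<close> and \<open>(x, False)\<close> for its formal inverse.\<close>

type_synonym 'a letter = "'a \<times> bool"

definition inv_letter :: "'a letter \<Rightarrow> 'a letter"
  where "inv_letter l = (fst l, \<not> snd l)"

definition reduced_word :: "'a letter list \<Rightarrow> bool"
  where "reduced_word w \<longleftrightarrow> successively (\<lambda>l l'. l' \<noteq> inv_letter l) w"

text \<open>The reduced form of \<open>l # w\<close>, for reduced \<open>w\<close>.\<close>

fun push :: "'a letter \<Rightarrow> 'a letter list \<Rightarrow> 'a letter list"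
  where
    "push l [] = [l]"
  | "push l (l' # w) = (if l' = inv_letter l then w else l # l' # w)"

text \<open>Elements are the reduced words, so \<^const>\<open>length\<close> is the word length
  with respect to the free generators.\<close>

definition free_group :: "'a set \<Rightarrow> 'a letter list monoid"
  where "free_group X =
    \<lparr>carrier = {w. reduced_word w \<and> fst ` set w \<subseteq> X}, monoid.mult = foldr push, one = []\<rparr>"

definition free_gen :: "'a \<Rightarrow> 'a letter list"
  where "free_gen x = [(x, True)]"

definition normal_closure :: "('a, 'b) monoid_scheme \<Rightarrow> 'a set \<Rightarrow> 'a set"
  where "normal_closure G R = \<Inter>{N. N \<lhd> G \<and> R \<subseteq> N}"


section \<open>Marked groups\<close>

text \<open>A marked group is a pair of a group \<open>G\<close> and a list \<open>S = [s\<^sub>0, \<dots>, s\<^sub>k\<^sub>-\<^sub>1]\<close>; the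
  \<open>k\<close> generators are numbered from \<open>0\<close>.\<close>

fun marked_group :: "nat \<Rightarrow> 'a monoid \<times> 'a list \<Rightarrow> bool"
  where "marked_group k (G, S) \<longleftrightarrow>
    group G \<and> length S = k \<and> set S \<subseteq> carrier G \<and> generate G (set S) = carrier G"

fun marked_iso :: "'a monoid \<times> 'a list \<Rightarrow> 'b monoid \<times> 'b list \<Rightarrow> bool"
  where "marked_iso (G, S) (H, T) \<longleftrightarrow> (\<exists>\<phi>\<in>iso G H. map \<phi> S = T)"

text \<open>A finitely generated group is countable, so every marked group, over any type, is
  isomorphic to one whose carrier is a set of natural numbers. Its isomorphism class is therefore
  represented by the nonempty set of all marked groups over \<^typ>\<open>nat\<close> isomorphic to it; see
  \<open>marked_class_in_space\<close> and \<open>marked_class_eq_iff\<close> below.\<close>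

type_synonym marked_class = "(nat monoid \<times> nat list) set"

definition marked_class :: "nat \<Rightarrow> 'a monoid \<times> 'a list \<Rightarrow> marked_class"
  where "marked_class k M = {N. marked_group k N \<and> marked_iso M N}"

definition marked_space :: "nat \<Rightarrow> marked_class set"
  where "marked_space k = {marked_class k M |M :: nat monoid \<times> nat list. marked_group k M}"

fun canonical_map :: "'a monoid \<times> 'a list \<Rightarrow> nat letter list \<Rightarrow> 'a"
  where "canonical_map (G, S) w =
    foldr (\<lambda>l g. (if snd l then S ! fst l else inv\<^bsub>G\<^esub> (S ! fst l)) \<otimes>\<^bsub>G\<^esub> g) w \<one>\<^bsub>G\<^esub>"

text \<open>All members of a class have the same trivial words; see \<open>trivial_words_marked_class\<close> below.\<close>

definition trivial_words :: "nat \<Rightarrow> marked_class \<Rightarrow> nat letter list set"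
  where "trivial_words k X =
    {w \<in> carrier (free_group {..<k}). \<exists>M\<in>X. canonical_map M w = \<one>\<^bsub>fst M\<^esub>}"

definition marked_dist :: "nat \<Rightarrow> marked_class \<Rightarrow> marked_class \<Rightarrow> real"
  where "marked_dist k X Y =
    (if X = Y then 0
     else exp (- real (LEAST n. \<exists>w \<in> carrier (free_group {..<k}).
                 (w \<in> trivial_words k X) \<noteq> (w \<in> trivial_words k Y) \<and> length w = n)))"

definition marked_topology :: "nat \<Rightarrow> marked_class topology"
  where "marked_topology k = Metric_space.mtopology (marked_space k) (marked_dist k)"


section \<open>Presented groups and Baumslag--Solitar groups\<close>

definition presented :: "nat \<Rightarrow> nat letter list set \<Rightarrow>
    nat letter list set monoid \<times> nat letter list set list"
  where "presented k R =
    (let F = free_group {..<k}; N = normal_closure F R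
     in (F Mod N, map (\<lambda>i. N #>\<^bsub>F\<^esub> free_gen i) [0..<k]))"

definition BS :: "int \<Rightarrow> int \<Rightarrow> nat letter list set monoid \<times> nat letter list set list"
  where "BS m n =
    (let F = free_group {..<2}; a = free_gen 0; b = free_gen 1
     in presented 2 {(a \<otimes>\<^bsub>F\<^esub> b [^]\<^bsub>F\<^esub> m \<otimes>\<^bsub>F\<^esub> inv\<^bsub>F\<^esub> a) \<otimes>\<^bsub>F\<^esub> inv\<^bsub>F\<^esub> (b [^]\<^bsub>F\<^esub> n)})"


section \<open>The wreath product of the integers with themselves\<close>

definition semidirect_product ::
    "'h monoid \<Rightarrow> 'n monoid \<Rightarrow> ('h \<Rightarrow> 'n \<Rightarrow> 'n) \<Rightarrow> ('h \<times> 'n) monoid"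
  where "semidirect_product H N \<alpha> =
    \<lparr>carrier = carrier H \<times> carrier N,
     monoid.mult = (\<lambda>(h, x) (h', x'). (h \<otimes>\<^bsub>H\<^esub> h', x \<otimes>\<^bsub>N\<^esub> \<alpha> h x')),
     one = (\<one>\<^bsub>H\<^esub>, \<one>\<^bsub>N\<^esub>)\<rparr>"

definition wreath_int :: "(int \<times> (int \<Rightarrow> int)) monoid"
  where "wreath_int =
    semidirect_product integer_group (sum_group UNIV (\<lambda>_. integer_group)) (\<lambda>k x i. x (i - k))"

definition dirac :: "int \<Rightarrow> int \<Rightarrow> int"
  where "dirac i = (\<lambda>j. if j = i then 1 else 0)"

definition marked_wreath_int :: "(int \<times> (int \<Rightarrow> int)) monoid \<times> (int \<times> (int \<Rightarrow> int)) list"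
  where "marked_wreath_int = (wreath_int, [(1, \<lambda>_. 0), (0, dirac 0)])"


section \<open>The free group is a group\<close>

lemma inv_letter_inv_letter [simp]: "inv_letter (inv_letter l) = l"
  by (simp add: inv_letter_def)

lemma inv_letter_neq [simp]: "inv_letter l \<noteq> l" "l \<noteq> inv_letter l"
  by (auto simp: inv_letter_def prod_eq_iff)

lemma fst_inv_letter [simp]: "fst (inv_letter l) = fst l"
  by (simp add: inv_letter_def)

lemma reduced_Nil [simp]: "reduced_word []"
  by (simp add: reduced_word_def)

lemma reduced_Cons: "reduced_word (l # w) \<longleftrightarrow> reduced_word w \<and> (w = [] \<or> hd w \<noteq> inv_letter l)"
  by (auto simp: reduced_word_def successively_Cons)

lemma reduced_push: "reduced_word w \<Longrightarrow> reduced_word (push l w)"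
  by (cases w) (auto simp: reduced_Cons)

lemma push_push_inv: "reduced_word w \<Longrightarrow> push l (push (inv_letter l) w) = w"
proof (cases w)
  case (Cons l' v)
  assume "reduced_word w"
  with Cons show ?thesis by (cases v) (auto simp: reduced_Cons)
qed auto

lemma reduced_foldr_push: "reduced_word w \<Longrightarrow> reduced_word (foldr push v w)"
  by (induction v) (auto intro: reduced_push)

lemma foldr_push_push:
  assumes "reduced_word w" shows "foldr push (push l v) w = push l (foldr push v w)"
  by (cases v) (auto simp: push_push_inv assms reduced_foldr_push)

lemma foldr_push_assoc:
  "reduced_word w \<Longrightarrow> foldr push (foldr push u v) w = foldr push u (foldr push v w)"
  by (induction u) (auto simp: foldr_push_push)

lemma set_push: "set (push l w) \<subseteq> insert l (set w)"
  by (cases w) auto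

lemma set_foldr_push: "set (foldr push v w) \<subseteq> set v \<union> set w"
  by (induction v) (use set_push in \<open>fastforce+\<close>)

lemma foldr_push_Nil: "reduced_word v \<Longrightarrow> foldr push v [] = v"
proof (induction v)
  case (Cons l v)
  then show ?case by (cases v) (auto simp: reduced_Cons)
qed simp

lemma foldr_push_inverse: "reduced_word u \<Longrightarrow> foldr push (rev (map inv_letter v)) (foldr push v u) = u"
proof (induction v arbitrary: u)
  case (Cons l v)
  then show ?case
    using push_push_inv[of "foldr push v u" "inv_letter l"] by (simp add: reduced_foldr_push)
qed simp

lemma group_free_group: "group (free_group X)"
proof (rule groupI)
  fix u v w
  assume u: "u \<in> carrier (free_group X)" and v: "v \<in> carrier (free_group X)"
  show "u \<otimes>\<^bsub>free_group X\<^esub> v \<in> carrier (free_group X)"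
    using u v set_foldr_push[of u v] by (fastforce simp: free_group_def reduced_foldr_push)
  assume w: "w \<in> carrier (free_group X)"
  show "u \<otimes>\<^bsub>free_group X\<^esub> v \<otimes>\<^bsub>free_group X\<^esub> w = u \<otimes>\<^bsub>free_group X\<^esub> (v \<otimes>\<^bsub>free_group X\<^esub> w)"
    using w by (auto simp: free_group_def foldr_push_assoc)
next
  fix u
  assume u: "u \<in> carrier (free_group X)"
  define v where "v = rev (map inv_letter u)"
  have "foldr push v u = []"
    using foldr_push_inverse[of "[]" u] u by (simp add: v_def free_group_def foldr_push_Nil)
  moreover have "reduced_word v"
  proof -
    have "successively (\<lambda>l l'. l' \<noteq> inv_letter l) u"
      using u by (simp add: free_group_def reduced_word_def)
    then have "successively (\<lambda>l l'. inv_letter l \<noteq> inv_letter (inv_letter l')) u"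
      by (rule successively_mono) (metis inv_letter_inv_letter)
    then show ?thesis
      by (simp add: v_def reduced_word_def successively_map)
  qed
  moreover have "fst ` set v \<subseteq> X"
    using u by (auto simp: v_def free_group_def)
  ultimately show "\<exists>v\<in>carrier (free_group X). v \<otimes>\<^bsub>free_group X\<^esub> u = \<one>\<^bsub>free_group X\<^esub>"
    by (auto simp: free_group_def)
qed (auto simp: free_group_def)

lemma free_gen_in_carrier: "x \<in> X \<Longrightarrow> free_gen x \<in> carrier (free_group X)"
  by (simp add: free_gen_def free_group_def reduced_Cons)


section \<open>The space of marked groups\<close>

lemma canonical_map_Nil [simp]: "canonical_map (G, S) [] = \<one>\<^bsub>G\<^esub>"
  by simp

lemma canonical_map_Cons:
  "canonical_map (G, S) (l # w) =
    (if snd l then S ! fst l else inv\<^bsub>G\<^esub> (S ! fst l)) \<otimes>\<^bsub>G\<^esub> canonical_map (G, S) w"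
  by simp

declare canonical_map.simps [simp del]

lemma canonical_map_closed:
  assumes "marked_group k (G, S)" "fst ` set w \<subseteq> {..<k}"
  shows "canonical_map (G, S) w \<in> carrier G"
proof -
  interpret group G using assms by simp
  have "canonical_map (G, S) w \<in> carrier G" if "fst ` set w \<subseteq> {..<k}" for w
    using that
  proof (induction w)
    case (Cons l w)
    then have "S ! fst l \<in> carrier G"
      using assms by auto
    with Cons show ?case by (simp add: canonical_map_Cons)
  qed simp
  then show ?thesis using assms by blast
qed

lemma canonical_map_push:
  assumes M: "marked_group k (G, S)" and l: "fst l < k" and w: "fst ` set w \<subseteq> {..<k}"
  shows "canonical_map (G, S) (push l w) = canonical_map (G, S) (l # w)"
proof (cases "\<exists>v. w = inv_letter l # v")
  case True
  then obtain v where v: "w = inv_letter l # v" by blast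
  interpret group G using M by simp
  have s: "S ! fst l \<in> carrier G" using M l by auto
  have c: "canonical_map (G, S) v \<in> carrier G"
    using canonical_map_closed[OF M] w v by simp
  show ?thesis
    using s c by (cases "snd l") (auto simp: v canonical_map_Cons inv_letter_def m_assoc[symmetric])
next
  case False
  then show ?thesis by (cases w) auto
qed

lemma canonical_map_foldr_push:
  assumes M: "marked_group k (G, S)" and "fst ` set v \<subseteq> {..<k}" and w: "fst ` set w \<subseteq> {..<k}"
  shows "canonical_map (G, S) (foldr push v w) =
    canonical_map (G, S) v \<otimes>\<^bsub>G\<^esub> canonical_map (G, S) w"
proof -
  interpret group G using M by simp
  show ?thesis
    using assms(2)
  proof (induction v)
    case Nil
    show ?case using canonical_map_closed[OF M w] by simp
  next
    case (Cons l v)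
    have "fst ` set (foldr push v w) \<subseteq> {..<k}"
      using set_foldr_push[of v w] Cons.prems w by fastforce
    moreover have "S ! fst l \<in> carrier G" using M Cons.prems by auto
    moreover have "canonical_map (G, S) v \<in> carrier G"
      using canonical_map_closed[OF M] Cons.prems by simp
    ultimately show ?case
      using Cons canonical_map_closed[OF M w]
      by (auto simp: canonical_map_push[OF M] canonical_map_Cons m_assoc)
  qed
qed

lemma canonical_map_hom:
  assumes "marked_group k (G, S)"
  shows "canonical_map (G, S) \<in> hom (free_group {..<k}) G"
  using canonical_map_closed[OF assms] canonical_map_foldr_push[OF assms]
  by (auto simp: hom_def free_group_def)

lemma canonical_map_free_gen:
  assumes "marked_group k (G, S)" "i < k"
  shows "canonical_map (G, S) (free_gen i) = S ! i"
proof -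
  interpret group G using assms by simp
  have "S ! i \<in> carrier G" using assms by auto
  then show ?thesis by (simp add: free_gen_def canonical_map_Cons)
qed

lemma canonical_map_surj:
  assumes M: "marked_group k (G, S)"
  shows "canonical_map (G, S) ` carrier (free_group {..<k}) = carrier G"
proof -
  interpret G: group G using M by simp
  interpret F: group "free_group {..<k}" by (rule group_free_group)
  interpret h: group_hom "free_group {..<k}" G "canonical_map (G, S)"
    by (intro group_hom.intro group_hom_axioms.intro canonical_map_hom[OF M] F.is_group G.is_group)
  have "set S \<subseteq> canonical_map (G, S) ` carrier (free_group {..<k})"
  proof
    fix s assume "s \<in> set S"
    then obtain i where "i < k" "s = S ! i" using M by (auto simp: in_set_conv_nth)
    then have "s = canonical_map (G, S) (free_gen i)" "free_gen i \<in> carrier (free_group {..<k})"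
      by (simp_all add: canonical_map_free_gen[OF M] free_gen_in_carrier)
    then show "s \<in> canonical_map (G, S) ` carrier (free_group {..<k})" by blast
  qed
  then have "generate G (set S) \<subseteq> canonical_map (G, S) ` carrier (free_group {..<k})"
    using G.generate_subgroup_incl h.img_is_subgroup by blast
  then show ?thesis using M h.hom_closed by auto
qed

lemma canonical_map_iso:
  assumes M: "marked_group k (G, S)" and \<phi>: "\<phi> \<in> iso G H" and H: "group H"
    and w: "fst ` set w \<subseteq> {..<k}"
  shows "canonical_map (H, map \<phi> S) w = \<phi> (canonical_map (G, S) w)"
proof -
  interpret h: group_hom G H \<phi>
    using M H \<phi> by (simp add: group_hom_def group_hom_axioms_def iso_def)
  show ?thesis
    using w
  proof (induction w)
    case (Cons l w)
    then have "S ! fst l \<in> carrier G" "canonical_map (G, S) w \<in> carrier G" "fst l < length S"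
      using M canonical_map_closed[OF M] by auto
    with Cons show ?case by (auto simp: canonical_map_Cons)
  qed simp
qed

lemma canonical_map_marked_iso:
  assumes M: "marked_group k M" and N: "marked_group k N" and MN: "marked_iso M N"
    and w: "w \<in> carrier (free_group {..<k})"
  shows "canonical_map M w = \<one>\<^bsub>fst M\<^esub> \<longleftrightarrow> canonical_map N w = \<one>\<^bsub>fst N\<^esub>"
proof -
  obtain G S H T where eq: "M = (G, S)" "N = (H, T)" by (metis surj_pair)
  obtain \<phi> where \<phi>: "\<phi> \<in> iso G H" "T = map \<phi> S" using MN eq by auto
  have H: "group H" and G: "group G" using M N eq by auto
  interpret h: group_hom G H \<phi>
    using G H \<phi> by (simp add: group_hom_def group_hom_axioms_def iso_def)
  have w': "fst ` set w \<subseteq> {..<k}" using w by (simp add: free_group_def)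
  have inj: "inj_on \<phi> (carrier G)" using \<phi> by (simp add: iso_def bij_betw_def)
  have "canonical_map (G, S) w \<in> carrier G"
    using canonical_map_closed w' M eq by blast
  then have "\<phi> (canonical_map (G, S) w) = \<one>\<^bsub>H\<^esub> \<longleftrightarrow> canonical_map (G, S) w = \<one>\<^bsub>G\<^esub>"
    using inj_on_eq_iff[OF inj _ h.G.one_closed] by simp
  then show ?thesis
    using canonical_map_iso[of k G S \<phi> H w] M \<phi> H w' by (simp add: eq)
qed

lemma marked_iso_if_same_kernel:
  assumes M: "marked_group k M" and N: "marked_group k N"
    and ker: "\<And>w. w \<in> carrier (free_group {..<k}) \<Longrightarrow>
      canonical_map M w = \<one>\<^bsub>fst M\<^esub> \<longleftrightarrow> canonical_map N w = \<one>\<^bsub>fst N\<^esub>"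
  shows "marked_iso M N"
proof -
  obtain G S H T where eq: "M = (G, S)" "N = (H, T)" by (metis surj_pair)
  let ?F = "free_group {..<k}" and ?f = "canonical_map (G, S)" and ?g = "canonical_map (H, T)"
  have M': "marked_group k (G, S)" and N': "marked_group k (H, T)" using M N eq by auto
  interpret F: group ?F by (rule group_free_group)
  interpret G: group G using M' by simp
  interpret H: group H using N' by simp
  interpret f: group_hom ?F G ?f
    by (intro group_hom.intro group_hom_axioms.intro canonical_map_hom[OF M'] F.is_group G.is_group)
  interpret g: group_hom ?F H ?g
    by (intro group_hom.intro group_hom_axioms.intro canonical_map_hom[OF N'] F.is_group H.is_group)
  have fg: "?f u = ?f v \<longleftrightarrow> ?g u = ?g v" if "u \<in> carrier ?F" "v \<in> carrier ?F" for u v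
  proof -
    have "?f u = ?f v \<longleftrightarrow> ?f (u \<otimes>\<^bsub>?F\<^esub> inv\<^bsub>?F\<^esub> v) = \<one>\<^bsub>G\<^esub>"
      using that by (simp add: G.inv_solve_right')
    also have "\<dots> \<longleftrightarrow> ?g (u \<otimes>\<^bsub>?F\<^esub> inv\<^bsub>?F\<^esub> v) = \<one>\<^bsub>H\<^esub>"
      using ker[of "u \<otimes>\<^bsub>?F\<^esub> inv\<^bsub>?F\<^esub> v"] that eq by simp
    also have "\<dots> \<longleftrightarrow> ?g u = ?g v"
      using that by (simp add: H.inv_solve_right')
    finally show ?thesis .
  qed
  define \<phi> where "\<phi> x = ?g (inv_into (carrier ?F) ?f x)" for x
  have \<phi>f: "\<phi> (?f u) = ?g u" if u: "u \<in> carrier ?F" for u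
  proof -
    have "inv_into (carrier ?F) ?f (?f u) \<in> carrier ?F"
      "?f (inv_into (carrier ?F) ?f (?f u)) = ?f u"
      using u by (auto intro: inv_into_into f_inv_into_f)
    then show ?thesis using fg u by (simp add: \<phi>_def)
  qed
  have surjf: "carrier G = ?f ` carrier ?F" and surjg: "carrier H = ?g ` carrier ?F"
    using canonical_map_surj[OF M'] canonical_map_surj[OF N'] by auto
  have "\<phi> \<in> hom G H"
  proof (rule homI)
    fix x y assume "x \<in> carrier G" "y \<in> carrier G"
    then obtain u v where uv: "u \<in> carrier ?F" "v \<in> carrier ?F" "x = ?f u" "y = ?f v"
      using surjf by auto
    then show "\<phi> x \<in> carrier H" by (simp add: \<phi>f)
    have "x \<otimes>\<^bsub>G\<^esub> y = ?f (u \<otimes>\<^bsub>?F\<^esub> v)" using uv by simp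
    then show "\<phi> (x \<otimes>\<^bsub>G\<^esub> y) = \<phi> x \<otimes>\<^bsub>H\<^esub> \<phi> y"
      using uv by (simp only: \<phi>f F.m_closed g.hom_mult)
  qed
  moreover have "bij_betw \<phi> (carrier G) (carrier H)"
    unfolding bij_betw_def
  proof
    show "inj_on \<phi> (carrier G)"
      using surjf fg by (auto simp: inj_on_def \<phi>f)
    show "\<phi> ` carrier G = carrier H"
      unfolding surjf surjg image_image by (rule image_cong) (auto simp: \<phi>f)
  qed
  moreover have "map \<phi> S = T"
  proof (rule nth_equalityI)
    fix i assume "i < length (map \<phi> S)"
    then have i: "i < k" using M' by simp
    then have "\<phi> (S ! i) = T ! i"
      using \<phi>f[of "free_gen i"]
      by (simp add: canonical_map_free_gen[OF M'] canonical_map_free_gen[OF N'] free_gen_in_carrier)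
    with i M' show "map \<phi> S ! i = T ! i" by simp
  qed (use M' N' in simp)
  ultimately show ?thesis by (auto simp: eq iso_def)
qed

lemma marked_iso_iff:
  assumes "marked_group k M" "marked_group k N"
  shows "marked_iso M N \<longleftrightarrow> (\<forall>w\<in>carrier (free_group {..<k}).
    canonical_map M w = \<one>\<^bsub>fst M\<^esub> \<longleftrightarrow> canonical_map N w = \<one>\<^bsub>fst N\<^esub>)"
  using canonical_map_marked_iso[OF assms] marked_iso_if_same_kernel[OF assms] by blast

lemma ex_nat_marked_group:
  fixes M :: "'a monoid \<times> 'a list"
  assumes M: "marked_group k M"
  shows "\<exists>N :: nat monoid \<times> nat list. marked_group k N \<and> marked_iso M N"
proof -
  obtain G S where eq: "M = (G, S)" by (metis surj_pair)
  interpret G: group G using M eq by simp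
  have M': "marked_group k (G, S)" using M eq by simp
  have "countable (carrier G)"
    unfolding canonical_map_surj[OF M', symmetric] by (intro countable_image countableI_type)
  then obtain f :: "'a \<Rightarrow> nat" where inj: "inj_on f (carrier G)"
    by (rule countableE)
  let ?g = "inv_into (carrier G) f"
  define H where "H = \<lparr>carrier = f ` carrier G,
    monoid.mult = (\<lambda>x y. f (?g x \<otimes>\<^bsub>G\<^esub> ?g y)), one = f \<one>\<^bsub>G\<^esub>\<rparr>"
  have gf: "?g (f x) = x" if "x \<in> carrier G" for x
    using inj that by simp
  have carrier_H: "carrier H = f ` carrier G"
    and one_H: "\<one>\<^bsub>H\<^esub> = f \<one>\<^bsub>G\<^esub>"
    by (simp_all add: H_def)
  have mult_H: "f a \<otimes>\<^bsub>H\<^esub> f b = f (a \<otimes>\<^bsub>G\<^esub> b)" if "a \<in> carrier G" "b \<in> carrier G" for a b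
    using that by (simp add: H_def gf)
  have "group H"
  proof (rule groupI)
    show "\<one>\<^bsub>H\<^esub> \<in> carrier H" by (simp add: carrier_H one_H)
    fix x assume "x \<in> carrier H"
    then obtain a where a: "a \<in> carrier G" "x = f a" unfolding carrier_H by blast
    then show "\<one>\<^bsub>H\<^esub> \<otimes>\<^bsub>H\<^esub> x = x" by (simp add: one_H mult_H)
    have "f (inv\<^bsub>G\<^esub> a) \<otimes>\<^bsub>H\<^esub> x = \<one>\<^bsub>H\<^esub>" using a by (simp add: one_H mult_H)
    moreover have "f (inv\<^bsub>G\<^esub> a) \<in> carrier H" using a by (simp add: carrier_H)
    ultimately show "\<exists>y\<in>carrier H. y \<otimes>\<^bsub>H\<^esub> x = \<one>\<^bsub>H\<^esub>" by blast
    fix y assume "y \<in> carrier H"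
    then obtain b where b: "b \<in> carrier G" "y = f b" unfolding carrier_H by blast
    show "x \<otimes>\<^bsub>H\<^esub> y \<in> carrier H" using a b by (simp add: carrier_H mult_H)
    fix z assume "z \<in> carrier H"
    then obtain c where c: "c \<in> carrier G" "z = f c" unfolding carrier_H by blast
    show "x \<otimes>\<^bsub>H\<^esub> y \<otimes>\<^bsub>H\<^esub> z = x \<otimes>\<^bsub>H\<^esub> (y \<otimes>\<^bsub>H\<^esub> z)"
      using a b c by (simp add: mult_H G.m_assoc)
  qed
  have hom: "f \<in> hom G H"
    by (rule homI) (simp_all add: carrier_H mult_H)
  have \<phi>: "f \<in> iso G H"
    using inj hom by (simp add: iso_def bij_betw_def carrier_H)
  interpret h: group_hom G H f
    by (intro group_hom.intro group_hom_axioms.intro G.is_group \<open>group H\<close> hom)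
  have "generate H (set (map f S)) = carrier H"
    using h.generate_img[of "set S"] M' by (simp add: carrier_H)
  then have "marked_group k (H, map f S)"
    using M' \<open>group H\<close> by (auto simp: carrier_H)
  moreover have "marked_iso M (H, map f S)" using \<phi> by (auto simp: eq)
  ultimately show ?thesis by blast
qed

theorem marked_class_eq_iff:
  assumes M: "marked_group k M" and N: "marked_group k N"
  shows "marked_class k M = marked_class k N \<longleftrightarrow> marked_iso M N"
proof
  assume eq: "marked_class k M = marked_class k N"
  obtain L :: "nat monoid \<times> nat list" where L: "marked_group k L" "marked_iso M L"
    using ex_nat_marked_group[OF M] by blast
  then have "marked_iso N L" using eq by (auto simp: marked_class_def)
  then show "marked_iso M N"
    using L M N by (simp add: marked_iso_iff)
next
  assume "marked_iso M N"
  then show "marked_class k M = marked_class k N"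
    using M N by (auto simp: marked_class_def marked_iso_iff)
qed

theorem marked_class_in_space:
  assumes "marked_group k M"
  shows "marked_class k M \<in> marked_space k"
proof -
  obtain N :: "nat monoid \<times> nat list" where N: "marked_group k N" "marked_iso M N"
    using ex_nat_marked_group[OF assms] by blast
  then have "marked_class k M = marked_class k N"
    using assms by (simp add: marked_class_eq_iff)
  then show ?thesis using N unfolding marked_space_def by blast
qed

theorem trivial_words_marked_class:
  assumes M: "marked_group k M"
  shows "trivial_words k (marked_class k M) =
    {w \<in> carrier (free_group {..<k}). canonical_map M w = \<one>\<^bsub>fst M\<^esub>}"
proof -
  obtain N :: "nat monoid \<times> nat list" where "marked_group k N" "marked_iso M N"
    using ex_nat_marked_group[OF M] by blast
  then have "N \<in> marked_class k M" by (simp add: marked_class_def)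
  moreover have "canonical_map L w = \<one>\<^bsub>fst L\<^esub> \<longleftrightarrow> canonical_map M w = \<one>\<^bsub>fst M\<^esub>"
    if "L \<in> marked_class k M" "w \<in> carrier (free_group {..<k})" for L w
    using canonical_map_marked_iso[OF M, of L w] that by (simp add: marked_class_def)
  ultimately show ?thesis
    unfolding trivial_words_def by blast
qed

lemma trivial_words_inject:
  assumes "X \<in> marked_space k" "Y \<in> marked_space k" "trivial_words k X = trivial_words k Y"
  shows "X = Y"
proof -
  obtain M N :: "nat monoid \<times> nat list" where M: "marked_group k M" "X = marked_class k M"
    and N: "marked_group k N" "Y = marked_class k N"
    using assms unfolding marked_space_def by blast
  have "marked_iso M N"
    using assms(3) M N by (auto simp: marked_iso_iff trivial_words_marked_class)
  then show ?thesis using M N by (simp add: marked_class_eq_iff)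
qed

theorem marked_dist_ultrametric:
  assumes X: "X \<in> marked_space k" and Y: "Y \<in> marked_space k" and Z: "Z \<in> marked_space k"
  shows "marked_dist k X Z \<le> max (marked_dist k X Y) (marked_dist k Y Z)"
proof (cases "X = Z")
  case True
  then show ?thesis by (simp add: marked_dist_def le_max_iff_disj)
next
  case False
  let ?P = "\<lambda>X Y n. \<exists>w \<in> carrier (free_group {..<k}).
    (w \<in> trivial_words k X) \<noteq> (w \<in> trivial_words k Y) \<and> length w = n"
  have "trivial_words k X \<noteq> trivial_words k Z"
    using trivial_words_inject X Z False by blast
  moreover have "trivial_words k X \<subseteq> carrier (free_group {..<k})"
    "trivial_words k Z \<subseteq> carrier (free_group {..<k})"
    by (auto simp: trivial_words_def)
  ultimately have "\<exists>n. ?P X Z n" by blast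
  then have "?P X Z (LEAST n. ?P X Z n)" by (rule LeastI_ex)
  then obtain w where w: "w \<in> carrier (free_group {..<k})"
    "(w \<in> trivial_words k X) \<noteq> (w \<in> trivial_words k Z)" "length w = (LEAST n. ?P X Z n)"
    by blast
  have le: "marked_dist k X Z \<le> marked_dist k U V"
    if "(w \<in> trivial_words k U) \<noteq> (w \<in> trivial_words k V)" for U V
  proof -
    have "(LEAST n. ?P U V n) \<le> length w"
      using that w(1) by (intro Least_le) blast
    moreover have "U \<noteq> V" using that by blast
    ultimately show ?thesis using False w(3) by (simp add: marked_dist_def)
  qed
  show ?thesis
    using le[of X Y] le[of Y Z] w(2) by (meson le_max_iff_disj)
qed

theorem Metric_space_marked_space: "Metric_space (marked_space k) (marked_dist k)"
proof
  show nn: "0 \<le> marked_dist k X Y" for X Y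
    by (simp add: marked_dist_def)
  show "marked_dist k X Y = marked_dist k Y X" for X Y
  proof -
    have "(\<exists>w \<in> carrier (free_group {..<k}).
        (w \<in> trivial_words k X) \<noteq> (w \<in> trivial_words k Y) \<and> length w = n) \<longleftrightarrow>
      (\<exists>w \<in> carrier (free_group {..<k}).
        (w \<in> trivial_words k Y) \<noteq> (w \<in> trivial_words k X) \<and> length w = n)" for n
      by blast
    then show ?thesis unfolding marked_dist_def by presburger
  qed
  show "marked_dist k X Y = 0 \<longleftrightarrow> X = Y" for X Y
    by (simp add: marked_dist_def)
  show "marked_dist k X Z \<le> marked_dist k X Y + marked_dist k Y Z"
    if "X \<in> marked_space k" "Y \<in> marked_space k" "Z \<in> marked_space k" for X Y Z
    using marked_dist_ultrametric[OF that] nn[of X Y] nn[of Y Z] by linarith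
qed


section \<open>The conjugation convention in the wreath product\<close>

lemma carrier_wreath_int: "carrier wreath_int = {(k, x). finite {i. x i \<noteq> 0}}"
  by (auto simp: wreath_int_def semidirect_product_def carrier_sum_group)

lemma mult_wreath_int: "(k, x) \<otimes>\<^bsub>wreath_int\<^esub> (l, y) = (k + l, \<lambda>i. x i + y (i - k))"
  by (simp add: wreath_int_def semidirect_product_def fun_eq_iff)

lemma one_wreath_int: "\<one>\<^bsub>wreath_int\<^esub> = (0, \<lambda>_. 0)"
  by (auto simp: wreath_int_def semidirect_product_def)

lemma finite_shift: "finite {i. (x (i - k) :: int) \<noteq> 0}" if "finite {i. x i \<noteq> 0}" for k :: int
proof -
  have "{i. x (i - k) \<noteq> 0} \<subseteq> (\<lambda>i. i + k) ` {i. x i \<noteq> 0}"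
  proof
    fix i assume "i \<in> {i. x (i - k) \<noteq> 0}"
    then show "i \<in> (\<lambda>i. i + k) ` {i. x i \<noteq> 0}" by (intro image_eqI[of _ _ "i - k"]) auto
  qed
  then show ?thesis using that by (meson finite_imageI finite_subset)
qed

lemma group_wreath_int: "group wreath_int"
proof (rule groupI)
  fix p q assume "p \<in> carrier wreath_int" "q \<in> carrier wreath_int"
  then obtain k x l y where eq: "p = (k, x)" "q = (l, y)"
    and fin: "finite {i. x i \<noteq> 0}" "finite {i. y i \<noteq> 0}"
    by (auto simp: carrier_wreath_int)
  have "{i. x i + y (i - k) \<noteq> 0} \<subseteq> {i. x i \<noteq> 0} \<union> {i. y (i - k) \<noteq> 0}" by auto
  then have "finite {i. x i + y (i - k) \<noteq> 0}"
    by (rule finite_subset) (use fin finite_shift[of y k] in simp)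
  then show "p \<otimes>\<^bsub>wreath_int\<^esub> q \<in> carrier wreath_int"
    by (simp add: eq mult_wreath_int carrier_wreath_int)
next
  fix p assume "p \<in> carrier wreath_int"
  then obtain k x where eq: "p = (k, x)" and fin: "finite {i. x i \<noteq> 0}"
    by (auto simp: carrier_wreath_int)
  have "(- k, \<lambda>i. - x (i - (- k))) \<in> carrier wreath_int"
    using finite_shift[OF fin, of "- k"] by (simp add: carrier_wreath_int)
  moreover have "(- k, \<lambda>i. - x (i - (- k))) \<otimes>\<^bsub>wreath_int\<^esub> p = \<one>\<^bsub>wreath_int\<^esub>"
    by (simp add: eq mult_wreath_int one_wreath_int)
  ultimately show "\<exists>q\<in>carrier wreath_int. q \<otimes>\<^bsub>wreath_int\<^esub> p = \<one>\<^bsub>wreath_int\<^esub>" by blast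
qed (auto simp: carrier_wreath_int mult_wreath_int one_wreath_int add.assoc diff_diff_eq)

lemma wreath_int_conjugation:
  "(1, \<lambda>_. 0) \<otimes>\<^bsub>wreath_int\<^esub> (0, dirac i) \<otimes>\<^bsub>wreath_int\<^esub> inv\<^bsub>wreath_int\<^esub> (1, \<lambda>_. 0) = (0, dirac (i + 1))"
proof -
  have "inv\<^bsub>wreath_int\<^esub> (1, \<lambda>_. 0) = (- 1, \<lambda>_. 0)"
    by (rule group.inv_equality[OF group_wreath_int])
      (auto simp: carrier_wreath_int mult_wreath_int one_wreath_int)
  then show ?thesis
    by (auto simp: mult_wreath_int dirac_def fun_eq_iff)
qed

end

theory Submission
  imports Defs "HOL-Algebra.Bij"
begin

text \<open>
  The direct sum of copies of \<open>\<int>\<close> is the additive group of Laurent polynomials with integer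
  coefficients, on which the shift acts as multiplication by the variable. So a word \<open>w\<close> in the
  letters \<open>a, b\<close> has in \<open>\<int> \<wr> \<int>\<close> a value \<open>(k, x)\<close>, with \<open>k\<close> the exponent sum of \<open>a\<close> in \<open>w\<close>
  and \<open>x\<close> a Laurent polynomial. The proof rests on a description of the trivial words of
  \<open>BS(1, n)\<close> in these terms, for \<open>\<bar>n\<bar> \<ge> 2\<close> (\<open>canonical_map_BS_eq_one_iff\<close>): \<open>w\<close> is trivial in
  \<open>BS(1, n)\<close> if and only if \<open>k = 0\<close> and \<open>x(n) = 0\<close>.

  One direction is the affine representation \<open>a \<mapsto> (t \<mapsto> n t)\<close>, \<open>b \<mapsto> (t \<mapsto> t + 1)\<close> of \<open>BS(1, n)\<close>,
  which sends \<open>w\<close> to \<open>t \<mapsto> n\<^sup>k t + x(n)\<close>. As an action of words it factors through \<open>\<int> \<wr> \<int>\<close> and is set up there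
  (\<open>affine_action\<close>). For the other direction, the element \<open>a\<^sup>-\<^sup>m b a\<^sup>m\<close> of \<open>BS(1, n)\<close> is an
  \<open>n\<^sup>m\<close>-th root of \<open>b\<close>, and for \<open>m \<ge> length w\<close> all conjugates of \<open>b\<close> that occur in \<open>w\<close> are
  powers of it. Collecting them gives \<open>w = (a\<^sup>-\<^sup>m b a\<^sup>m)\<^sup>e a\<^sup>k\<close> with \<open>e = n\<^sup>m x(n)\<close>
  (\<open>canonical_map_normal_form\<close>), which is trivial as soon as \<open>k = 0\<close> and \<open>x(n) = 0\<close>.

  Every coefficient of \<open>x\<close> is at most \<open>length w\<close> in absolute value, and a nonzero Laurent
  polynomial whose coefficients are smaller than \<open>\<bar>n\<bar>\<close> in absolute value does not vanish at \<open>n\<close>: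
  its lowest coefficient would be divisible by \<open>n\<close>. Hence the words of length at most \<open>L\<close> that are
  trivial in \<open>BS(1, n)\<close> are those trivial in \<open>\<int> \<wr> \<int>\<close> once \<open>\<bar>n\<bar>\<close> exceeds \<open>L\<close> and \<open>1\<close>, which is
  convergence. Finally \<open>a b\<^sup>-\<^sup>1 a\<^sup>-\<^sup>1 = b\<^sup>n\<close> says the same as \<open>a b a\<^sup>-\<^sup>1 = b\<^sup>-\<^sup>n\<close>, so that
  \<open>BS(-1, n) = BS(1, -n)\<close> and the second limit is an instance of the first.
\<close>

section \<open>Groups given by a presentation\<close>

lemma normal_closure_normal:
  assumes "group G" "R \<subseteq> carrier G"
  shows "normal_closure G R \<lhd> G"
proof -
  interpret group G by fact
  have ne: "carrier G \<in> {N. N \<lhd> G \<and> R \<subseteq> N}"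
    using assms(2) normal_self by blast
  have "subgroup (normal_closure G R) G"
    unfolding normal_closure_def
    by (rule subgroups_Inter) (use ne normal_imp_subgroup in blast)+
  moreover have "x \<otimes>\<^bsub>G\<^esub> h \<otimes>\<^bsub>G\<^esub> inv\<^bsub>G\<^esub> x \<in> normal_closure G R"
    if "x \<in> carrier G" "h \<in> normal_closure G R" for x h
    using that normal_invE(2) by (auto simp: normal_closure_def)
  ultimately show ?thesis by (simp add: normal_inv_iff)
qed

lemma normal_closure_superset: "R \<subseteq> normal_closure G R"
  by (auto simp: normal_closure_def)

lemma (in normal) r_coset_eq_one_iff:
  assumes "g \<in> carrier G"
  shows "H #> g = \<one>\<^bsub>G Mod H\<^esub> \<longleftrightarrow> g \<in> H"
  using assms rcos_self[OF assms] coset_join2[OF assms] subgroup_axioms by (auto simp: FactGroup_def)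

text \<open>This is von Dyck's theorem in the form needed here: a homomorphism that kills the relators
  factors through the presented group.\<close>

lemma hom_eq_one_on_normal_closure:
  assumes "group_hom G H h" "R \<subseteq> carrier G" "\<And>r. r \<in> R \<Longrightarrow> h r = \<one>\<^bsub>H\<^esub>"
    and "g \<in> normal_closure G R"
  shows "h g = \<one>\<^bsub>H\<^esub>"
proof -
  have "kernel G H h \<lhd> G" "R \<subseteq> kernel G H h"
    using assms group_hom.normal_kernel by (auto simp: kernel_def)
  then have "g \<in> kernel G H h"
    using assms(4) by (auto simp: normal_closure_def)
  then show ?thesis by (simp add: kernel_def)
qed

lemma marked_groupI:
  assumes G: "group G" and S: "length S = k" "set S \<subseteq> carrier G"
    and words: "\<And>g. g \<in> carrier G \<Longrightarrow> \<exists>w. fst ` set w \<subseteq> {..<k} \<and> g = canonical_map (G, S) w"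
  shows "marked_group k (G, S)"
proof -
  interpret group G by fact
  have "canonical_map (G, S) w \<in> generate G (set S)" if "fst ` set w \<subseteq> {..<k}" for w
    using that
  proof (induction w)
    case (Cons l w)
    then have "S ! fst l \<in> set S" using S by auto
    with Cons show ?case
      by (auto simp: canonical_map_Cons intro: generate.eng generate.incl generate.inv)
  qed (simp add: generate.one)
  then have "generate G (set S) = carrier G"
    using words generate_incl[OF S(2)] by blast
  with G S show ?thesis by simp
qed

text \<open>Elements of the free group are reduced words, so that the canonical epimorphism onto a
  presented group, computed letter by letter, is the quotient map itself. Both claims come from
  this one computation, since surjectivity of the quotient map is what shows that the marking
  generates.\<close>

lemma
  assumes R: "R \<subseteq> carrier (free_group {..<k})"
  shows marked_group_presented: "marked_group k (presented k R)"
    and canonical_map_presented: "w \<in> carrier (free_group {..<k}) \<Longrightarrow>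
      canonical_map (presented k R) w = normal_closure (free_group {..<k}) R #>\<^bsub>free_group {..<k}\<^esub> w"
proof -
  let ?F = "free_group {..<k}"
  interpret F: group ?F by (rule group_free_group)
  define N where "N = normal_closure ?F R"
  interpret N: normal N ?F
    unfolding N_def by (rule normal_closure_normal[OF F.is_group R])
  let ?Q = "?F Mod N" and ?\<pi> = "\<lambda>w. N #>\<^bsub>?F\<^esub> w"
  interpret Q: group ?Q by (rule N.factorgroup_is_group)
  interpret \<pi>: group_hom ?F ?Q ?\<pi>
    by (intro group_hom.intro group_hom_axioms.intro N.r_coset_hom_Mod F.is_group Q.is_group)
  define S where "S = map (\<lambda>i. ?\<pi> (free_gen i)) [0..<k]"
  have eq: "presented k R = (?Q, S)"
    by (simp add: presented_def Let_def N_def S_def)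
  have letter: "?\<pi> [l] = (if snd l then S ! fst l else inv\<^bsub>?Q\<^esub> (S ! fst l))" if "fst l < k" for l
  proof (cases l)
    case (Pair i e)
    have "inv\<^bsub>?F\<^esub> (free_gen i) = [(i, False)]"
      by (rule F.inv_equality)
        (use that Pair in \<open>auto simp: free_gen_def free_group_def reduced_Cons inv_letter_def\<close>)
    then show ?thesis
      using that Pair \<pi>.hom_inv[of "free_gen i"] free_gen_in_carrier[of i "{..<k}"]
      by (cases e) (simp_all add: S_def free_gen_def)
  qed
  have can: "canonical_map (?Q, S) w = ?\<pi> w" if "w \<in> carrier ?F" for w
    using that
  proof (induction w)
    case Nil
    have "?\<pi> [] = \<one>\<^bsub>?Q\<^esub>" using \<pi>.hom_one by (simp add: free_group_def)
    then show ?case by simp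
  next
    case (Cons l w)
    then have w: "w \<in> carrier ?F" and l: "[l] \<in> carrier ?F" "fst l < k"
      by (auto simp: free_group_def reduced_Cons)
    have "l # w = [l] \<otimes>\<^bsub>?F\<^esub> w"
      using Cons.prems by (cases w) (auto simp: free_group_def reduced_Cons)
    then have "?\<pi> (l # w) = ?\<pi> [l] \<otimes>\<^bsub>?Q\<^esub> ?\<pi> w"
      using w l by (simp del: mult_FactGroup)
    then show ?case
      using Cons.IH[OF w] letter[OF l(2)] by (simp add: canonical_map_Cons del: mult_FactGroup)
  qed
  have "set S \<subseteq> carrier ?Q"
    by (auto simp: S_def simp del: carrier_FactGroup intro!: \<pi>.hom_closed free_gen_in_carrier)
  moreover have "\<exists>w. fst ` set w \<subseteq> {..<k} \<and> g = canonical_map (?Q, S) w" if "g \<in> carrier ?Q" for g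
  proof -
    obtain w where "w \<in> carrier ?F" "g = ?\<pi> w"
      using \<open>g \<in> carrier ?Q\<close> by (auto simp: FactGroup_def RCOSETS_def)
    then show ?thesis
      using can[of w] by (auto simp: free_group_def intro!: exI[of _ w])
  qed
  ultimately show "marked_group k (presented k R)"
    unfolding eq by (intro marked_groupI Q.is_group) (auto simp: S_def)
  show "canonical_map (presented k R) w = normal_closure ?F R #>\<^bsub>?F\<^esub> w" if "w \<in> carrier ?F"
    using can[OF that] by (simp add: eq N_def)
qed

section \<open>Laurent polynomials\<close>

text \<open>A finitely supported \<open>x\<close> is read as the Laurent polynomial with coefficient \<open>x i\<close> at degree
  \<open>i\<close>. The evaluation point is real because negative powers of \<open>n\<close> occur.\<close>

definition laurent_eval :: "real \<Rightarrow> (int \<Rightarrow> int) \<Rightarrow> real"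
  where "laurent_eval q x = (\<Sum>i | x i \<noteq> 0. of_int (x i) * q powi i)"

lemma laurent_eval_superset:
  assumes "finite I" "{i. x i \<noteq> 0} \<subseteq> I"
  shows "laurent_eval q x = (\<Sum>i\<in>I. of_int (x i) * q powi i)"
  unfolding laurent_eval_def by (rule sum.mono_neutral_left) (use assms in auto)

lemma laurent_eval_zero [simp]: "laurent_eval q (\<lambda>_. 0) = 0"
  by (simp add: laurent_eval_def)

lemma laurent_eval_dirac [simp]: "laurent_eval q (dirac i) = q powi i"
  by (subst laurent_eval_superset[of "{i}"]) (auto simp: dirac_def)

lemma laurent_eval_add:
  assumes "finite {i. x i \<noteq> 0}" "finite {i. y i \<noteq> 0}"
  shows "laurent_eval q (\<lambda>i. x i + y i) = laurent_eval q x + laurent_eval q y"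
proof -
  let ?I = "{i. x i \<noteq> 0} \<union> {i. y i \<noteq> 0}"
  have "finite ?I" using assms by simp
  then show ?thesis
    by (subst (1 2 3) laurent_eval_superset[of ?I])
      (auto simp: sum.distrib[symmetric] ring_distribs)
qed

lemma laurent_eval_uminus: "laurent_eval q (\<lambda>i. - x i) = - laurent_eval q x"
  by (simp add: laurent_eval_def sum_negf)

lemma laurent_eval_shift:
  assumes "q \<noteq> 0"
  shows "laurent_eval q (\<lambda>i. x (i - k)) = q powi k * laurent_eval q x"
proof -
  have "laurent_eval q (\<lambda>i. x (i - k)) = (\<Sum>i | x i \<noteq> 0. of_int (x i) * q powi (i + k))"
    unfolding laurent_eval_def
    by (rule sum.reindex_bij_witness[of _ "\<lambda>i. i + k" "\<lambda>i. i - k"]) auto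
  also have "\<dots> = q powi k * laurent_eval q x"
    using assms by (simp add: laurent_eval_def sum_distrib_left power_int_add mult_ac)
  finally show ?thesis .
qed

text \<open>Let \<open>j\<close> be the lowest degree that occurs. After division by \<open>n\<^sup>j\<close> all remaining terms but the
  constant one, \<open>x j\<close>, are integers divisible by \<open>n\<close>; hence so is \<open>x j\<close>, which is too small for
  that unless it vanishes.\<close>

lemma laurent_eval_eq_0_imp_eq_0:
  assumes fin: "finite {i. x i \<noteq> 0}" and small: "\<And>i. \<bar>x i\<bar> < \<bar>n\<bar>" and eval: "laurent_eval (of_int n) x = 0"
  shows "x = (\<lambda>_. 0)"
proof (rule ccontr)
  assume "x \<noteq> (\<lambda>_. 0)"
  then have ne: "{i. x i \<noteq> 0} \<noteq> {}" by auto
  define j where "j = Min {i. x i \<noteq> 0}"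
  have j: "x j \<noteq> 0" and least: "\<And>i. x i \<noteq> 0 \<Longrightarrow> j \<le> i"
    using Min_in[OF fin ne] Min_le[OF fin] by (auto simp: j_def)
  have n: "n \<noteq> 0" using small[of 0] by auto
  let ?I = "{i. x i \<noteq> 0} - {j}"
  have "0 = laurent_eval (of_int n) (\<lambda>i. x (i - (- j)))"
    using eval n laurent_eval_shift[of "of_int n" x "- j"] by simp
  also have "\<dots> = (\<Sum>i | x i \<noteq> 0. of_int (x i) * of_int n powi (i - j))"
    unfolding laurent_eval_def
    by (rule sum.reindex_bij_witness[of _ "\<lambda>i. i - j" "\<lambda>i. i + j"]) auto
  also have "\<dots> = of_int (x j) + (\<Sum>i\<in>?I. of_int (x i) * of_int n powi (i - j))"
    using j by (simp add: sum.remove[OF fin, of j])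
  also have "(\<Sum>i\<in>?I. of_int (x i) * of_int n powi (i - j)) =
      (\<Sum>i\<in>?I. real_of_int (n * (x i * n ^ nat (i - j - 1))))"
  proof (rule sum.cong[OF refl])
    fix i assume "i \<in> ?I"
    then have "i - j = int (Suc (nat (i - j - 1)))"
      using least[of i] by auto
    then have "real_of_int n powi (i - j) = of_int n ^ Suc (nat (i - j - 1))"
      by (metis power_int_of_nat)
    then show "of_int (x i) * real_of_int n powi (i - j) = of_int (n * (x i * n ^ nat (i - j - 1)))"
      by simp
  qed
  finally have "real_of_int (x j + n * (\<Sum>i\<in>?I. x i * n ^ nat (i - j - 1))) = 0"
    by (simp add: sum_distrib_left)
  then have "x j = n * - (\<Sum>i\<in>?I. x i * n ^ nat (i - j - 1))"
    by linarith
  then have "n dvd x j" by (metis dvd_triv_left)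
  then show False
    using j small[of j] by (metis abs_ge_self dvd_imp_le_int not_less)
qed

section \<open>Words in the wreath product\<close>

lemma inv_wreath_int_shift: "inv\<^bsub>wreath_int\<^esub> (k, \<lambda>_. 0) = (- k, \<lambda>_. 0)"
  by (rule group.inv_equality[OF group_wreath_int])
    (auto simp: carrier_wreath_int mult_wreath_int one_wreath_int)

lemma finite_dirac [simp]: "finite {i. dirac j i \<noteq> 0}"
  by (simp add: dirac_def)

lemma inv_wreath_int_dirac: "inv\<^bsub>wreath_int\<^esub> (0, dirac i) = (0, \<lambda>j. - dirac i j)"
  by (rule group.inv_equality[OF group_wreath_int])
    (auto simp: carrier_wreath_int mult_wreath_int one_wreath_int)

text \<open>The powers of the two generators are found by transporting the powers of \<open>1\<close> in the integers
  along a homomorphism; this treats negative exponents together with positive ones.\<close>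

lemma wreath_int_pow_shift: "(1, \<lambda>_. 0) [^]\<^bsub>wreath_int\<^esub> (k :: int) = (k, \<lambda>_. 0)"
proof -
  have "(\<lambda>k. (k, \<lambda>_. 0)) \<in> hom integer_group wreath_int"
    by (rule homI) (simp_all add: carrier_wreath_int mult_wreath_int)
  from hom_int_pow[OF this, of 1 k] show ?thesis
    by (simp add: group_wreath_int)
qed

lemma wreath_int_pow_dirac: "(0, dirac i) [^]\<^bsub>wreath_int\<^esub> (c :: int) = (0, \<lambda>j. c * dirac i j)"
proof -
  have "(\<lambda>c. (0, \<lambda>j. c * dirac i j)) \<in> hom integer_group wreath_int"
    by (rule homI) (simp_all add: carrier_wreath_int mult_wreath_int dirac_def algebra_simps)
  from hom_int_pow[OF this, of 1 c] show ?thesis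
    by (simp add: group_wreath_int)
qed

lemma marked_group_wreath_int: "marked_group 2 marked_wreath_int"
proof -
  interpret group wreath_int by (rule group_wreath_int)
  define S where "S = [(1, \<lambda>_. 0), (0 :: int, dirac 0)]"
  let ?H = "generate wreath_int (set S)"
  have S: "set S \<subseteq> carrier wreath_int"
    by (auto simp: S_def carrier_wreath_int)
  have sub: "subgroup ?H wreath_int"
    by (rule generate_is_subgroup[OF S])
  interpret H: subgroup ?H wreath_int by (rule sub)
  have a: "(1, \<lambda>_. 0) \<in> ?H" and b: "(0, dirac 0) \<in> ?H"
    by (auto simp: S_def intro: generate.incl)
  have shift: "(k, \<lambda>_. 0) \<in> ?H" for k
    using subgroup_int_pow_closed[OF sub a, of k] by (simp add: wreath_int_pow_shift)
  have dirac: "(0, dirac i) \<in> ?H" for i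
  proof -
    have "(i, \<lambda>_. 0) \<otimes>\<^bsub>wreath_int\<^esub> (0, dirac 0) \<otimes>\<^bsub>wreath_int\<^esub> (- i, \<lambda>_. 0) = (0, dirac i)"
      by (auto simp: mult_wreath_int dirac_def fun_eq_iff)
    then show ?thesis using H.m_closed[OF H.m_closed[OF shift b] shift] by metis
  qed
  have mult_dirac: "(0, \<lambda>j. c * dirac i j) \<in> ?H" for c i
    using subgroup_int_pow_closed[OF sub dirac, of i c] by (simp add: wreath_int_pow_dirac)
  have base: "(0, x) \<in> ?H" if "finite I" "{i. x i \<noteq> 0} \<subseteq> I" for x I
    using that
  proof (induction I arbitrary: x)
    case empty
    then have "x = (\<lambda>_. 0)" by auto
    then show ?case using H.one_closed by (simp add: one_wreath_int)
  next
    case (insert j I)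
    have "(0, x(j := 0)) \<in> ?H" using insert by (intro insert.IH) auto
    moreover have "(0, \<lambda>i. x j * dirac j i) \<otimes>\<^bsub>wreath_int\<^esub> (0, x(j := 0)) = (0, x)"
      by (auto simp: mult_wreath_int dirac_def fun_eq_iff)
    ultimately show ?case using H.m_closed[OF mult_dirac[of "x j" j]] by metis
  qed
  have "carrier wreath_int \<subseteq> ?H"
  proof
    fix p assume "p \<in> carrier wreath_int"
    then obtain k x where p: "p = (k, x)" "finite {i. x i \<noteq> 0}"
      by (auto simp: carrier_wreath_int)
    have "p = (0, x) \<otimes>\<^bsub>wreath_int\<^esub> (k, \<lambda>_. 0)"
      by (simp add: p mult_wreath_int)
    then show "p \<in> ?H" using H.m_closed[OF base[OF p(2)] shift] by auto
  qed
  then have "?H = carrier wreath_int" using H.subset by blast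
  then show ?thesis
    using S group_wreath_int by (simp add: marked_wreath_int_def S_def)
qed

abbreviation wreath_value :: "nat letter list \<Rightarrow> int \<times> (int \<Rightarrow> int)"
  where "wreath_value \<equiv> canonical_map marked_wreath_int"

lemma wreath_value_Nil: "wreath_value [] = (0, \<lambda>_. 0)"
  by (simp add: marked_wreath_int_def one_wreath_int)

lemma wreath_value_Cons:
  assumes "wreath_value w = (k, x)"
  shows "wreath_value ((0, True) # w) = (k + 1, \<lambda>i. x (i - 1))"
    and "wreath_value ((0, False) # w) = (k - 1, \<lambda>i. x (i - (- 1)))"
    and "wreath_value ((1, True) # w) = (k, \<lambda>i. dirac 0 i + x i)"
    and "wreath_value ((1, False) # w) = (k, \<lambda>i. - dirac 0 i + x i)"
  using assms
  by (simp_all add: marked_wreath_int_def canonical_map_Cons inv_wreath_int_shift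
      inv_wreath_int_dirac mult_wreath_int)

lemma two_letters_induct [consumes 1, case_names Nil a a_inv b b_inv]:
  assumes "fst ` set w \<subseteq> {..<2::nat}"
    and "P []"
    and "\<And>w. fst ` set w \<subseteq> {..<2} \<Longrightarrow> P w \<Longrightarrow> P ((0, True) # w)"
    and "\<And>w. fst ` set w \<subseteq> {..<2} \<Longrightarrow> P w \<Longrightarrow> P ((0, False) # w)"
    and "\<And>w. fst ` set w \<subseteq> {..<2} \<Longrightarrow> P w \<Longrightarrow> P ((1, True) # w)"
    and "\<And>w. fst ` set w \<subseteq> {..<2} \<Longrightarrow> P w \<Longrightarrow> P ((1, False) # w)"
  shows "P w"
  using assms(1)
proof (induction w)
  case (Cons l w)
  obtain i e where l: "l = (i, e)" by (cases l)
  have "i = 0 \<or> i = 1" using Cons.prems l by auto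
  with Cons l assms(3-6)[of w] show ?case by (cases e) auto
qed (use assms(2) in simp)

lemma wreath_value_finite:
  assumes "fst ` set w \<subseteq> {..<2}" "wreath_value w = (k, x)"
  shows "finite {i. x i \<noteq> 0}"
proof -
  have "wreath_value w \<in> carrier wreath_int"
    using canonical_map_closed marked_group_wreath_int assms(1)
    unfolding marked_wreath_int_def by blast
  then show ?thesis using assms(2) by (simp add: carrier_wreath_int)
qed

text \<open>Each letter \<open>b\<^sup>\<plusminus>\<^sup>1\<close> changes a single coefficient, by one; the letters \<open>a\<^sup>\<plusminus>\<^sup>1\<close> only shift the
  coefficients.\<close>

lemma wreath_value_abs_le:
  assumes "fst ` set w \<subseteq> {..<2}" "wreath_value w = (k, x)"
  shows "\<bar>x i\<bar> \<le> int (length w)"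
  using assms
proof (induction w arbitrary: k x i rule: two_letters_induct)
  case Nil
  then show ?case by (auto simp: wreath_value_Nil)
next
  case (a w)
  obtain l y where y: "wreath_value w = (l, y)" by fastforce
  have "\<bar>y (i - 1)\<bar> \<le> int (length w)" by (rule a.IH[OF y])
  then show ?case using a.prems wreath_value_Cons(1)[OF y] by auto
next
  case (a_inv w)
  obtain l y where y: "wreath_value w = (l, y)" by fastforce
  have "\<bar>y (i - (- 1))\<bar> \<le> int (length w)" by (rule a_inv.IH[OF y])
  then show ?case using a_inv.prems wreath_value_Cons(2)[OF y] by auto
next
  case (b w)
  obtain l y where y: "wreath_value w = (l, y)" by fastforce
  have "\<bar>y i\<bar> \<le> int (length w)" by (rule b.IH[OF y])
  then show ?case using b.prems wreath_value_Cons(3)[OF y] by (auto simp: dirac_def)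
next
  case (b_inv w)
  obtain l y where y: "wreath_value w = (l, y)" by fastforce
  have "\<bar>y i\<bar> \<le> int (length w)" by (rule b_inv.IH[OF y])
  then show ?case using b_inv.prems wreath_value_Cons(4)[OF y] by (auto simp: dirac_def)
qed

section \<open>Trivial words in the Baumslag--Solitar groups\<close>

text \<open>The element \<open>A\<^sup>-\<^sup>m B A\<^sup>m\<close>. In a group where \<open>A B A\<^sup>-\<^sup>1 = B\<^sup>n\<close> it is an \<open>n\<^sup>m\<close>-th root of \<open>B\<close>;
  see \<open>conj_root_pow\<close> below.\<close>

definition conj_root :: "'a monoid \<Rightarrow> 'a \<Rightarrow> 'a \<Rightarrow> nat \<Rightarrow> 'a"
  where "conj_root G A B m = ((\<lambda>g. inv\<^bsub>G\<^esub> A \<otimes>\<^bsub>G\<^esub> g \<otimes>\<^bsub>G\<^esub> A) ^^ m) B"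

text \<open>Conjugation by \<open>g\<close> is a homomorphism, so it carries powers of \<open>x\<close> to powers of \<open>y\<close>.
  Equations \<open>g x = y g\<close> are used in place of \<open>g x g\<^sup>-\<^sup>1 = y\<close> because they move \<open>g\<close> past a power
  inside a longer product.\<close>

lemma (in group) intertwine_int_pow:
  assumes "g \<in> carrier G" "x \<in> carrier G" "y \<in> carrier G" and gx: "g \<otimes> x = y \<otimes> g"
  shows "g \<otimes> x [^] (e :: int) = y [^] e \<otimes> g"
proof -
  let ?c = "\<lambda>h. g \<otimes> h \<otimes> inv g"
  have hom: "?c \<in> hom G G"
    using assms(1) by (intro homI) (simp_all add: m_assoc inv_solve_left)
  have "?c x = y" using assms by (simp add: inv_solve_right')
  then have "?c (x [^] e) = y [^] e"
    using hom_int_pow[OF hom] assms is_group by metis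
  then show ?thesis using assms by (simp add: inv_solve_right')
qed

context
  fixes G :: "'a monoid" (structure) and A B and n :: int
  assumes G: "group G"
    and A: "A \<in> carrier G" and B: "B \<in> carrier G" and rel: "A \<otimes> B = B [^] n \<otimes> A"
begin

interpretation group G by (rule G)

lemma conj_root_closed: "conj_root G A B m \<in> carrier G"
  by (induction m) (auto simp: conj_root_def A B)

lemma conj_root_Suc: "A \<otimes> conj_root G A B (Suc m) = conj_root G A B m \<otimes> A"
  using A conj_root_closed[of m]
  by (simp add: conj_root_def m_assoc[symmetric])

text \<open>The next two lemmas carry the relation \<open>A B = B\<^sup>n A\<close> from \<open>B\<close> to all its conjugates
  \<open>D\<^sub>m = A\<^sup>-\<^sup>m B A\<^sup>m\<close>: from \<open>A D\<^sub>m = D\<^sub>m\<^sup>n A\<close> and \<open>A D\<^sub>m\<^sub>+\<^sub>1 = D\<^sub>m A\<close> one gets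
  \<open>A D\<^sub>m\<^sub>+\<^sub>1\<^sup>n = A D\<^sub>m\<close>, so \<open>D\<^sub>m\<^sub>+\<^sub>1\<^sup>n = D\<^sub>m\<close>, which turns the second equation into
  the relation for \<open>D\<^sub>m\<^sub>+\<^sub>1\<close>.\<close>

lemma conj_root_Suc_pow_if_intertwined:
  assumes "A \<otimes> conj_root G A B m = conj_root G A B m [^] n \<otimes> A"
  shows "conj_root G A B (Suc m) [^] n = conj_root G A B m"
proof -
  have "A \<otimes> conj_root G A B (Suc m) [^] n = A \<otimes> conj_root G A B m"
    using intertwine_int_pow[OF A conj_root_closed conj_root_closed conj_root_Suc] assms by metis
  then show ?thesis
    using A conj_root_closed by simp
qed

lemma conj_root_intertwined: "A \<otimes> conj_root G A B m = conj_root G A B m [^] n \<otimes> A"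
proof (induction m)
  case 0
  show ?case using rel by (simp add: conj_root_def)
next
  case (Suc m)
  then show ?case using conj_root_Suc conj_root_Suc_pow_if_intertwined by simp
qed

lemmas conj_root_Suc_pow = conj_root_Suc_pow_if_intertwined[OF conj_root_intertwined]

lemma conj_root_pow: "conj_root G A B m [^] (n ^ m) = B"
proof (induction m)
  case 0
  show ?case using B by (simp add: conj_root_def)
next
  case (Suc m)
  have "conj_root G A B (Suc m) [^] (n ^ Suc m) = (conj_root G A B (Suc m) [^] n) [^] (n ^ m)"
    using conj_root_closed by (simp add: int_pow_pow)
  then show ?case using Suc conj_root_Suc_pow by simp
qed

text \<open>Put \<open>D\<^sub>m = A\<^sup>-\<^sup>m B A\<^sup>m\<close>. The claim is made for all large \<open>m\<close> at once because a letter
  \<open>a\<^sup>-\<^sup>1\<close> in front of \<open>D\<^sub>m\<^sup>e A\<^sup>k\<close> leads to \<open>D\<^sub>m\<^sub>+\<^sub>1\<^sup>e A\<^sup>k\<^sup>-\<^sup>1\<close>, where the root has changed. The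
  bound \<open>length w \<le> m\<close> leaves room for one such step per letter. The remaining letters act on \<open>e\<close>
  just as they act on \<open>n\<^sup>m x(n)\<close>: the letter \<open>a\<close> multiplies it by \<open>n\<close>, and \<open>b\<^sup>\<plusminus>\<^sup>1\<close> adds
  \<open>\<plusminus> n\<^sup>m\<close>, since \<open>B = D\<^sub>m\<^sup>r\<close> for \<open>r = n\<^sup>m\<close>.\<close>

lemma canonical_map_normal_form:
  assumes n: "n \<noteq> 0" and "fst ` set w \<subseteq> {..<2}" "wreath_value w = (k, x)" "length w \<le> m"
  shows "\<exists>e. real_of_int e = of_int n ^ m * laurent_eval (of_int n) x \<and>
    canonical_map (G, [A, B]) w = conj_root G A B m [^] e \<otimes> A [^] k"
  using assms(2-)
proof (induction w arbitrary: k x m rule: two_letters_induct)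
  case Nil
  then show ?case by (auto simp: wreath_value_Nil intro!: exI[of _ 0])
next
  case (a w)
  let ?D = "conj_root G A B m"
  obtain l y where y: "wreath_value w = (l, y)" by fastforce
  obtain e where e: "real_of_int e = of_int n ^ m * laurent_eval (of_int n) y"
    "canonical_map (G, [A, B]) w = ?D [^] e \<otimes> A [^] l"
    using a.IH[OF y, of m] a.prems by auto
  have "canonical_map (G, [A, B]) ((0, True) # w) = A \<otimes> ?D [^] e \<otimes> A [^] l"
    using A conj_root_closed by (simp add: canonical_map_Cons e m_assoc)
  also have "\<dots> = (?D [^] n) [^] e \<otimes> A \<otimes> A [^] l"
    using intertwine_int_pow[OF A conj_root_closed _ conj_root_intertwined] conj_root_closed by simp
  also have "\<dots> = ?D [^] (n * e) \<otimes> A [^] (l + 1)"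
    using A conj_root_closed by (simp add: int_pow_pow m_assoc int_pow_mult add.commute[of l])
  finally show ?case
    using a.prems wreath_value_Cons(1)[OF y] e(1) n
    by (auto simp: laurent_eval_shift intro!: exI[of _ "n * e"])
next
  case (a_inv w)
  obtain p where m: "m = Suc p" using a_inv.prems by (cases m) auto
  let ?D = "conj_root G A B p" and ?E = "conj_root G A B (Suc p)"
  obtain l y where y: "wreath_value w = (l, y)" by fastforce
  obtain e where e: "real_of_int e = of_int n ^ p * laurent_eval (of_int n) y"
    "canonical_map (G, [A, B]) w = ?D [^] e \<otimes> A [^] l"
    using a_inv.IH[OF y, of p] a_inv.prems m by auto
  have *: "A \<otimes> ?E [^] e = ?D [^] e \<otimes> A"
    by (rule intertwine_int_pow[OF A conj_root_closed conj_root_closed conj_root_Suc])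
  have "inv A \<otimes> ?D [^] e = inv A \<otimes> (?D [^] e \<otimes> A) \<otimes> inv A"
    using A conj_root_closed by (simp add: m_assoc)
  also have "\<dots> = ?E [^] e \<otimes> inv A"
    unfolding *[symmetric] using A conj_root_closed by (simp add: m_assoc[symmetric])
  finally have **: "inv A \<otimes> ?D [^] e = ?E [^] e \<otimes> inv A" .
  have "canonical_map (G, [A, B]) ((0, False) # w) = inv A \<otimes> ?D [^] e \<otimes> A [^] l"
    using A conj_root_closed by (simp add: canonical_map_Cons e m_assoc)
  also have "\<dots> = ?E [^] e \<otimes> (A [^] (- 1 :: int) \<otimes> A [^] l)"
    using A conj_root_closed by (simp add: ** m_assoc int_pow_neg)
  also have "\<dots> = ?E [^] e \<otimes> A [^] (l - 1)"
    using A by (simp add: int_pow_mult[symmetric])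
  finally show ?case
    using a_inv.prems wreath_value_Cons(2)[OF y] e(1) n m laurent_eval_shift[of "of_int n" y "- 1"]
    by (auto simp: power_int_minus intro!: exI[of _ e])
next
  case (b w)
  let ?D = "conj_root G A B m"
  obtain l y where y: "wreath_value w = (l, y)" by fastforce
  obtain e where e: "real_of_int e = of_int n ^ m * laurent_eval (of_int n) y"
    "canonical_map (G, [A, B]) w = ?D [^] e \<otimes> A [^] l"
    using b.IH[OF y, of m] b.prems by auto
  have "canonical_map (G, [A, B]) ((1, True) # w) = ?D [^] (n ^ m) \<otimes> ?D [^] e \<otimes> A [^] l"
    using A B conj_root_closed by (simp add: canonical_map_Cons e m_assoc conj_root_pow)
  also have "\<dots> = ?D [^] (n ^ m + e) \<otimes> A [^] l"
    using conj_root_closed by (simp add: int_pow_mult)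
  finally show ?case
    using b.prems wreath_value_Cons(3)[OF y] e(1) wreath_value_finite[OF b.hyps y]
    by (auto simp: laurent_eval_add algebra_simps intro!: exI[of _ "n ^ m + e"])
next
  case (b_inv w)
  let ?D = "conj_root G A B m"
  obtain l y where y: "wreath_value w = (l, y)" by fastforce
  obtain e where e: "real_of_int e = of_int n ^ m * laurent_eval (of_int n) y"
    "canonical_map (G, [A, B]) w = ?D [^] e \<otimes> A [^] l"
    using b_inv.IH[OF y, of m] b_inv.prems by auto
  have "canonical_map (G, [A, B]) ((1, False) # w) = ?D [^] (- (n ^ m)) \<otimes> ?D [^] e \<otimes> A [^] l"
    using A B conj_root_closed by (simp add: canonical_map_Cons e m_assoc conj_root_pow int_pow_neg)
  also have "\<dots> = ?D [^] (- (n ^ m) + e) \<otimes> A [^] l"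
    using conj_root_closed by (simp only: int_pow_mult)
  moreover have "laurent_eval (of_int n) (\<lambda>i. - dirac 0 i + y i) = laurent_eval (of_int n) y - 1"
    using wreath_value_finite[OF b_inv.hyps y] by (subst laurent_eval_add) (simp_all add: laurent_eval_uminus)
  ultimately show ?case
    using b_inv.prems wreath_value_Cons(4)[OF y] e(1)
    by (auto simp: right_diff_distrib intro!: exI[of _ "- (n ^ m) + e"])
qed

end

lemma powi_eq_1_imp: "n powi k = 1 \<Longrightarrow> \<bar>n\<bar> > 1 \<Longrightarrow> k = 0" for n :: real
proof (rule ccontr)
  assume n: "n powi k = 1" "\<bar>n\<bar> > 1" and "k \<noteq> 0"
  have "\<bar>n\<bar> powi \<bar>k\<bar> = 1"
    using n(1) power_int_abs[of n k] by (cases "k \<ge> 0") (auto simp: power_int_minus)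
  then show False using one_less_power_int[OF n(2), of "\<bar>k\<bar>"] \<open>k \<noteq> 0\<close> by simp
qed

text \<open>The affine action of \<open>\<int> \<wr> \<int>\<close> on the real line in which \<open>a\<close> scales by \<open>q\<close> and \<open>b\<close> translates
  by \<open>1\<close>. For \<open>q = n\<close> the relator of \<open>BS(1, n)\<close> acts trivially.\<close>

definition affine_action :: "real \<Rightarrow> int \<times> (int \<Rightarrow> int) \<Rightarrow> real \<Rightarrow> real"
  where "affine_action q = (\<lambda>(k, x) t. q powi k * t + laurent_eval q x)"

lemma affine_action_Bij:
  assumes "q \<noteq> 0"
  shows "affine_action q p \<in> Bij UNIV"
proof -
  obtain k x where p: "p = (k, x)" by fastforce
  have "bij (affine_action q p)"
    by (rule bij_betw_byWitness[of _ "\<lambda>t. (t - laurent_eval q x) / q powi k"])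
      (use assms in \<open>auto simp: affine_action_def p\<close>)
  then show ?thesis by (simp add: Bij_def)
qed

lemma affine_action_mult:
  assumes "q \<noteq> 0"
  shows "affine_action q g \<otimes>\<^bsub>BijGroup UNIV\<^esub> affine_action q h = affine_action q g \<circ> affine_action q h"
  using affine_action_Bij[OF assms] by (auto simp: BijGroup_def compose_def)

lemma affine_action_hom:
  assumes q: "q \<noteq> 0"
  shows "affine_action q \<in> hom wreath_int (BijGroup UNIV)"
proof (rule homI)
  fix g h assume gh: "g \<in> carrier wreath_int" "h \<in> carrier wreath_int"
  obtain k x l y where eq: "g = (k, x)" "h = (l, y)" by fastforce
  have "laurent_eval q (\<lambda>i. x i + y (i - k)) = laurent_eval q x + q powi k * laurent_eval q y"
    using gh q finite_shift[of y k]
    by (simp add: eq carrier_wreath_int laurent_eval_add laurent_eval_shift)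
  then show "affine_action q (g \<otimes>\<^bsub>wreath_int\<^esub> h) =
      affine_action q g \<otimes>\<^bsub>BijGroup UNIV\<^esub> affine_action q h"
    using q unfolding affine_action_mult[OF q]
    by (auto simp: eq mult_wreath_int affine_action_def fun_eq_iff power_int_add algebra_simps)
qed (simp add: BijGroup_def affine_action_Bij q)

lemma affine_action_eq_one_iff:
  assumes "\<bar>q\<bar> > 1"
  shows "affine_action q (k, x) = \<one>\<^bsub>BijGroup UNIV\<^esub> \<longleftrightarrow> k = 0 \<and> laurent_eval q x = 0"
proof
  assume "affine_action q (k, x) = \<one>\<^bsub>BijGroup UNIV\<^esub>"
  then have *: "q powi k * t + laurent_eval q x = t" for t
    by (auto simp: affine_action_def BijGroup_def fun_eq_iff)
  have "laurent_eval q x = 0" "q powi k = 1" using *[of 0] *[of 1] by auto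
  then show "k = 0 \<and> laurent_eval q x = 0" using powi_eq_1_imp assms by blast
qed (auto simp: affine_action_def BijGroup_def fun_eq_iff)

definition BS_relator :: "int \<Rightarrow> int \<Rightarrow> nat letter list"
  where "BS_relator m n =
    (let F = free_group {..<2}; a = free_gen 0; b = free_gen 1
     in (a \<otimes>\<^bsub>F\<^esub> b [^]\<^bsub>F\<^esub> m \<otimes>\<^bsub>F\<^esub> inv\<^bsub>F\<^esub> a) \<otimes>\<^bsub>F\<^esub> inv\<^bsub>F\<^esub> (b [^]\<^bsub>F\<^esub> n))"

lemma BS_eq: "BS m n = presented 2 {BS_relator m n}"
  by (simp add: BS_def BS_relator_def Let_def)

lemma BS_relator_closed: "BS_relator m n \<in> carrier (free_group {..<2})"
proof -
  interpret F: group "free_group {..<2::nat}" by (rule group_free_group)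
  show ?thesis by (simp add: BS_relator_def Let_def free_gen_in_carrier)
qed

lemma hom_BS_relator_eq_one_iff:
  assumes "group_hom (free_group {..<2}) H h"
  shows "h (BS_relator m n) = \<one>\<^bsub>H\<^esub> \<longleftrightarrow>
    h (free_gen 0) \<otimes>\<^bsub>H\<^esub> h (free_gen 1) [^]\<^bsub>H\<^esub> m = h (free_gen 1) [^]\<^bsub>H\<^esub> n \<otimes>\<^bsub>H\<^esub> h (free_gen 0)"
proof -
  interpret h: group_hom "free_group {..<2}" H h by fact
  show ?thesis
    by (simp add: BS_relator_def Let_def free_gen_in_carrier h.hom_int_pow h.H.inv_solve_right')
qed

text \<open>Modulo any normal subgroup, \<open>a b\<^sup>-\<^sup>m = b\<^sup>n a\<close> and \<open>a b\<^sup>m = b\<^sup>-\<^sup>n a\<close> are equivalent: invert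
  both sides of \<open>a b\<^sup>-\<^sup>m a\<^sup>-\<^sup>1 = b\<^sup>n\<close>. So the two relators have the same normal
  closure, and the presented groups are equal, not just isomorphic.\<close>

lemma BS_uminus: "BS (- m) n = BS m (- n)"
proof -
  interpret F: group "free_group {..<2::nat}" by (rule group_free_group)
  have "BS_relator (- m) n \<in> N \<longleftrightarrow> BS_relator m (- n) \<in> N" if "N \<lhd> free_group {..<2}" for N
  proof -
    interpret N: normal N "free_group {..<2}" by fact
    let ?Q = "free_group {..<2} Mod N" and ?\<pi> = "\<lambda>w. N #>\<^bsub>free_group {..<2}\<^esub> w"
    interpret Q: group ?Q by (rule N.factorgroup_is_group)
    interpret \<pi>: group_hom "free_group {..<2}" ?Q ?\<pi>
      by (intro group_hom.intro group_hom_axioms.intro N.r_coset_hom_Mod F.is_group Q.is_group)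
    let ?a = "?\<pi> (free_gen 0)" and ?b = "?\<pi> (free_gen 1)"
    have ab: "?a \<in> carrier ?Q" "?b \<in> carrier ?Q"
      by (intro \<pi>.hom_closed free_gen_in_carrier; simp)+
    have imp: "?a \<otimes>\<^bsub>?Q\<^esub> ?b [^]\<^bsub>?Q\<^esub> (- i) = ?b [^]\<^bsub>?Q\<^esub> (- j) \<otimes>\<^bsub>?Q\<^esub> ?a"
      if "?a \<otimes>\<^bsub>?Q\<^esub> ?b [^]\<^bsub>?Q\<^esub> i = ?b [^]\<^bsub>?Q\<^esub> j \<otimes>\<^bsub>?Q\<^esub> ?a" for i j :: int
      using Q.intertwine_int_pow[OF ab(1) _ _ that, of "- 1"] ab
      by (simp add: Q.int_pow_pow del: mult_FactGroup carrier_FactGroup)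
    show ?thesis
      unfolding N.r_coset_eq_one_iff[OF BS_relator_closed, symmetric]
        hom_BS_relator_eq_one_iff[OF \<pi>.group_hom_axioms]
      using imp[of "- m" n] imp[of m "- n"] by auto
  qed
  then have "normal_closure (free_group {..<2}) {BS_relator (- m) n} =
      normal_closure (free_group {..<2}) {BS_relator m (- n)}"
    unfolding normal_closure_def by (intro arg_cong[of _ _ Inter]) auto
  then show ?thesis by (simp add: BS_eq presented_def)
qed

text \<open>The trivial words of \<open>BS(1, n)\<close> are read off from their values in \<open>\<int> \<wr> \<int>\<close>. For
  \<open>\<bar>n\<bar> = 1\<close> scaling by \<open>n\<close> has finite order, and the affine action would not determine the
  exponent sum of \<open>a\<close>.\<close>

lemma canonical_map_BS_eq_one_iff:
  assumes n: "\<bar>n\<bar> > 1" and w: "w \<in> carrier (free_group {..<2})" and val: "wreath_value w = (k, x)"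
  shows "canonical_map (BS 1 n) w = \<one>\<^bsub>fst (BS 1 n)\<^esub> \<longleftrightarrow> k = 0 \<and> laurent_eval (of_int n) x = 0"
    (is "?triv \<longleftrightarrow> _")
proof -
  let ?F = "free_group {..<2}" and ?r = "BS_relator 1 n"
  let ?N = "normal_closure ?F {?r}"
  interpret F: group "free_group {..<2::nat}" by (rule group_free_group)
  have r: "{?r} \<subseteq> carrier ?F" using BS_relator_closed by simp
  interpret N: normal ?N ?F
    by (rule normal_closure_normal[OF F.is_group r])
  let ?Q = "?F Mod ?N" and ?\<pi> = "\<lambda>w. ?N #>\<^bsub>?F\<^esub> w"
  let ?A = "?\<pi> (free_gen 0)" and ?B = "?\<pi> (free_gen 1)"
  interpret Q: group ?Q by (rule N.factorgroup_is_group)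
  interpret \<pi>: group_hom ?F ?Q ?\<pi>
    by (intro group_hom.intro group_hom_axioms.intro N.r_coset_hom_Mod F.is_group Q.is_group)
  have BS: "BS 1 n = (?Q, [?A, ?B])"
    by (simp add: BS_eq presented_def Let_def numeral_2_eq_2)
  have AB: "?A \<in> carrier ?Q" "?B \<in> carrier ?Q"
    by (intro \<pi>.hom_closed free_gen_in_carrier; simp)+
  have triv: "canonical_map (BS 1 n) w = \<one>\<^bsub>fst (BS 1 n)\<^esub> \<longleftrightarrow> w \<in> ?N"
    using canonical_map_presented[OF r w] N.r_coset_eq_one_iff[OF w] by (simp add: BS BS_eq[symmetric])
  show ?thesis
  proof
    \<comment> \<open>The quotient satisfies the relation, so the normal form applies in it, with exponent \<open>0\<close>.\<close>
    have "?\<pi> ?r = \<one>\<^bsub>?Q\<^esub>"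
      using N.r_coset_eq_one_iff[OF BS_relator_closed] normal_closure_superset[of "{?r}" ?F] by simp
    then have "?A \<otimes>\<^bsub>?Q\<^esub> ?B = ?B [^]\<^bsub>?Q\<^esub> n \<otimes>\<^bsub>?Q\<^esub> ?A"
      unfolding hom_BS_relator_eq_one_iff[OF \<pi>.group_hom_axioms] Q.int_pow_1[OF AB(2)] .
    moreover have "n \<noteq> 0" "fst ` set w \<subseteq> {..<2}"
      using n w by (auto simp: free_group_def)
    ultimately obtain e where "real_of_int e = of_int n ^ length w * laurent_eval (of_int n) x"
      "canonical_map (?Q, [?A, ?B]) w =
        conj_root ?Q ?A ?B (length w) [^]\<^bsub>?Q\<^esub> e \<otimes>\<^bsub>?Q\<^esub> ?A [^]\<^bsub>?Q\<^esub> k"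
      using canonical_map_normal_form[OF Q.is_group AB, of n w k x "length w"] val by blast
    moreover assume "k = 0 \<and> laurent_eval (of_int n) x = 0"
    ultimately have "canonical_map (?Q, [?A, ?B]) w = \<one>\<^bsub>?Q\<^esub> \<otimes>\<^bsub>?Q\<^esub> \<one>\<^bsub>?Q\<^esub>"
      by (simp del: mult_FactGroup carrier_FactGroup one_FactGroup)
    then show "canonical_map (BS 1 n) w = \<one>\<^bsub>fst (BS 1 n)\<^esub>"
      unfolding BS fst_conv Q.l_one[OF Q.one_closed] .
  next
    \<comment> \<open>A trivial word acts trivially on the line, because the affine action kills the relator.\<close>
    assume "canonical_map (BS 1 n) w = \<one>\<^bsub>fst (BS 1 n)\<^esub>"
    then have wN: "w \<in> ?N" using triv by simp
    let ?q = "real_of_int n" and ?W = wreath_int and ?P = "BijGroup (UNIV :: real set)"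
    define S where "S = [(1, \<lambda>_. 0), (0 :: int, dirac 0)]"
    have S: "marked_wreath_int = (?W, S)" "marked_group 2 (?W, S)"
      using marked_group_wreath_int by (simp_all add: marked_wreath_int_def S_def)
    have q: "?q \<noteq> 0" "\<bar>?q\<bar> > 1" using n by auto
    have value_hom: "wreath_value \<in> hom ?F ?W"
      using canonical_map_hom[OF S(2)] by (simp add: S(1))
    interpret h: group_hom ?F ?P "affine_action ?q \<circ> wreath_value"
      by (intro group_hom.intro group_hom_axioms.intro F.is_group group_BijGroup
          hom_compose[OF value_hom affine_action_hom[OF q(1)]])
    have gens: "wreath_value (free_gen 0) = (1, \<lambda>_. 0)" "wreath_value (free_gen 1) = (0, dirac 0)"
      using canonical_map_free_gen[OF S(2), of 0] canonical_map_free_gen[OF S(2), of 1]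
      by (simp_all add: S(1)) (simp_all add: S_def)
    have pow: "affine_action ?q (0, dirac 0) [^]\<^bsub>?P\<^esub> e = affine_action ?q (0, \<lambda>j. e * dirac 0 j)"
      for e :: int
      using hom_int_pow[OF affine_action_hom[OF q(1)], of "(0, dirac 0)" e]
      by (simp add: carrier_wreath_int group_wreath_int group_BijGroup wreath_int_pow_dirac)
    have "laurent_eval ?q (\<lambda>j. e * dirac 0 j) = e" for e
      by (subst laurent_eval_superset[of "{0}"]) (auto simp: dirac_def)
    then have "(affine_action ?q \<circ> wreath_value) ?r = \<one>\<^bsub>?P\<^esub>"
      unfolding hom_BS_relator_eq_one_iff[OF h.group_hom_axioms]
      unfolding o_apply gens pow affine_action_mult[OF q(1)]
      by (auto simp: affine_action_def fun_eq_iff algebra_simps)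
    then have "(affine_action ?q \<circ> wreath_value) w = \<one>\<^bsub>?P\<^esub>"
      using hom_eq_one_on_normal_closure[OF h.group_hom_axioms r _ wN] by blast
    then show "k = 0 \<and> laurent_eval ?q x = 0"
      using affine_action_eq_one_iff[OF q(2)] val by simp
  qed
qed

section \<open>Convergence\<close>

lemma marked_dist_less:
  assumes X: "X \<in> marked_space k" and Y: "Y \<in> marked_space k"
    and agree: "\<And>w. w \<in> carrier (free_group {..<k}) \<Longrightarrow> length w \<le> L \<Longrightarrow>
      w \<in> trivial_words k X \<longleftrightarrow> w \<in> trivial_words k Y"
  shows "marked_dist k X Y < exp (- real L)"
proof (cases "X = Y")
  case False
  let ?P = "\<lambda>n. \<exists>w \<in> carrier (free_group {..<k}).
    (w \<in> trivial_words k X) \<noteq> (w \<in> trivial_words k Y) \<and> length w = n"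
  have "trivial_words k X \<noteq> trivial_words k Y"
    using trivial_words_inject X Y False by blast
  moreover have "trivial_words k X \<subseteq> carrier (free_group {..<k})"
    "trivial_words k Y \<subseteq> carrier (free_group {..<k})"
    by (auto simp: trivial_words_def)
  ultimately have "\<exists>n. ?P n" by blast
  then have "?P (LEAST n. ?P n)" by (rule LeastI_ex)
  then have "L < (LEAST n. ?P n)" using agree by force
  then show ?thesis using False by (simp add: marked_dist_def)
qed (simp add: marked_dist_def)

text \<open>Closeness of marked groups means agreement of their trivial words up to a given length.\<close>

lemma limitin_marked_topologyI:
  assumes X: "\<And>n. X n \<in> marked_space k" and Y: "Y \<in> marked_space k"
    and agree: "\<And>L. \<forall>\<^sub>F n in F. \<forall>w \<in> carrier (free_group {..<k}). length w \<le> L \<longrightarrow>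
      (w \<in> trivial_words k (X n) \<longleftrightarrow> w \<in> trivial_words k Y)"
  shows "limitin (marked_topology k) X Y F"
  unfolding marked_topology_def Metric_space.limitin_metric[OF Metric_space_marked_space]
proof (intro conjI allI impI Y)
  fix e :: real assume "e > 0"
  obtain L :: nat where "- ln e < real L" using reals_Archimedean2 by blast
  then have "exp (- real L) < e" using \<open>e > 0\<close> by (metis exp_less_mono exp_ln minus_less_iff)
  from agree[of L] show "\<forall>\<^sub>F n in F. X n \<in> marked_space k \<and> marked_dist k (X n) Y < e"
  proof eventually_elim
    case (elim n)
    then have "marked_dist k (X n) Y < exp (- real L)"
      by (intro marked_dist_less[OF X Y]) blast
    with \<open>exp (- real L) < e\<close> X show ?case by simp
  qed
qed

lemma trivial_in_BS_iff_trivial_in_wreath_int: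
  assumes w: "w \<in> carrier (free_group {..<2})" and n: "\<bar>n\<bar> > int (length w)" "\<bar>n\<bar> > 1"
  shows "canonical_map (BS 1 n) w = \<one>\<^bsub>fst (BS 1 n)\<^esub> \<longleftrightarrow>
    wreath_value w = \<one>\<^bsub>fst marked_wreath_int\<^esub>"
proof -
  obtain k x where val: "wreath_value w = (k, x)" by fastforce
  have w': "fst ` set w \<subseteq> {..<2}" using w by (simp add: free_group_def)
  have "\<bar>x i\<bar> < \<bar>n\<bar>" for i
    using wreath_value_abs_le[OF w' val, of i] n by linarith
  then have "laurent_eval (of_int n) x = 0 \<longleftrightarrow> x = (\<lambda>_. 0)"
    using laurent_eval_eq_0_imp_eq_0[OF wreath_value_finite[OF w' val]] by auto
  then show ?thesis
    using canonical_map_BS_eq_one_iff[OF n(2) w val] val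
    by (simp add: marked_wreath_int_def one_wreath_int)
qed

text \<open>Stated along a function \<open>f\<close> rather than for \<open>n\<close> itself, so that it also covers
  \<open>BS(1, -n) = BS(-1, n)\<close>.\<close>

lemma limitin_BS_1:
  assumes "filterlim (\<lambda>n. \<bar>f n\<bar>) at_top F"
  shows "limitin (marked_topology 2) (\<lambda>n. marked_class 2 (BS 1 (f n))) (marked_class 2 marked_wreath_int) F"
proof (rule limitin_marked_topologyI)
  have BS: "marked_group 2 (BS 1 n)" for n
    unfolding BS_eq by (rule marked_group_presented) (simp add: BS_relator_closed)
  then show "marked_class 2 (BS 1 (f n)) \<in> marked_space 2" for n
    by (rule marked_class_in_space)
  show "marked_class 2 marked_wreath_int \<in> marked_space 2"
    by (rule marked_class_in_space[OF marked_group_wreath_int])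
  fix L
  have "\<forall>\<^sub>F n in F. max 1 (int L) + 1 \<le> \<bar>f n\<bar>"
    using assms unfolding filterlim_at_top by blast
  then show "\<forall>\<^sub>F n in F. \<forall>w \<in> carrier (free_group {..<2}). length w \<le> L \<longrightarrow>
      (w \<in> trivial_words 2 (marked_class 2 (BS 1 (f n))) \<longleftrightarrow>
       w \<in> trivial_words 2 (marked_class 2 marked_wreath_int))"
  proof eventually_elim
    case (elim n)
    then show ?case
      by (auto simp: trivial_words_marked_class[OF BS]
          trivial_words_marked_class[OF marked_group_wreath_int] trivial_in_BS_iff_trivial_in_wreath_int)
  qed
qed

theorem theorem2:
  shows "limitin (marked_topology 2) (\<lambda>n. marked_class 2 (BS 1 n)) (marked_class 2 marked_wreath_int)
      (filtercomap (\<lambda>n::int. \<bar>n\<bar>) at_top)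
    \<and> limitin (marked_topology 2) (\<lambda>n. marked_class 2 (BS (-1) n)) (marked_class 2 marked_wreath_int)
      (filtercomap (\<lambda>n::int. \<bar>n\<bar>) at_top)"
proof
  have lim: "filterlim (\<lambda>n::int. \<bar>n\<bar>) at_top (filtercomap (\<lambda>n. \<bar>n\<bar>) at_top)"
    by (rule filterlim_filtercomap)
  show "limitin (marked_topology 2) (\<lambda>n. marked_class 2 (BS 1 n)) (marked_class 2 marked_wreath_int)
      (filtercomap (\<lambda>n::int. \<bar>n\<bar>) at_top)"
    by (rule limitin_BS_1[OF lim])
  show "limitin (marked_topology 2) (\<lambda>n. marked_class 2 (BS (-1) n)) (marked_class 2 marked_wreath_int)
      (filtercomap (\<lambda>n::int. \<bar>n\<bar>) at_top)"
    unfolding BS_uminus by (rule limitin_BS_1) (simp add: lim)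
qed

end
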